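(* If $G$ is an $r$-layer triangular carbon nanosheet, then $\mathrm{gt}(G)=3$.
   Context: A geodesic in a graph $G$ is a shortest path between two vertices. A geodesic is maximal if it is not a subpath of another geodesic of $G$. A set $S\subseteq V(G)$ is a geodesic transversal of $G$ if every maximal geodesic of $G$ contains at least one vertex of $S$. The geodesic transversal number $\mathrm{gt}(G)$ is the minimum cardinality of a geodesic transversal of $G$. The $r$-layer triangular carbon nanosheet is the graph obtained from the triangular piece of the hexagonal lattice formed by $r$ rows consisting of $1,2,\dots,r$ hexagons (so with $r$ hexagons along each of the three sides) by attaching one pendant vertex at each of its three corners, that is, at the outermost vertex of each of the three corners. Equivalently, its vertices are the triples $(a,b,c)$ of nonnegative integers with $a+b+c\in\{r,r+1\}$, and two triples are adjacent if and only if they differ in exactly one coordinate, and in that coordinate they differ by exactly $1$. Its pendant vertices (vertices of degree $1$) are the three corner vertices $(r+1,0,0)$, $(0,r+1,0)$, $(0,0,r+1)$.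
   Formalization: The theorem is stated for r ≥ 2: for r = 1 (one hexagon with three pendant vertices) the two vertices (1,0,0) and (0,1,0) already form a geodesic transversal, so gt(G) ≤ 2 and the claim fails. *)

theory Defs
  imports
    "Graph_Theory.Pair_Digraph"
    "Graph_Theory.Vertex_Walk"
    "HOL-Library.Sublist"
begin

text \<open>
  An undirected simple graph is a \<^locale>\<open>pair_graph\<close>: a finite, loop-free digraph
  whose arc relation is symmetric. Paths are given by their vertex sequences, so an
  undirected path corresponds to a list up to reversal.
\<close>

definition geodesic :: "'a pair_pre_digraph \<Rightarrow> 'a list \<Rightarrow> bool" where
  "geodesic G p \<longleftrightarrow> vpath p G \<and>
     (\<forall>q. vpath q G \<and> hd q = hd p \<and> last q = last p \<longrightarrow> vwalk_length p \<le> vwalk_length q)"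

definition same_path :: "'a list \<Rightarrow> 'a list \<Rightarrow> bool" where
  "same_path p q \<longleftrightarrow> p = q \<or> rev p = q"

definition subpath :: "'a list \<Rightarrow> 'a list \<Rightarrow> bool" where
  "subpath p q \<longleftrightarrow> sublist p q \<or> sublist (rev p) q"

definition maximal_geodesic :: "'a pair_pre_digraph \<Rightarrow> 'a list \<Rightarrow> bool" where
  "maximal_geodesic G p \<longleftrightarrow> geodesic G p \<and>
     \<not> (\<exists>q. geodesic G q \<and> \<not> same_path p q \<and> subpath p q)"

definition geodesic_transversal :: "'a pair_pre_digraph \<Rightarrow> 'a set \<Rightarrow> bool" where
  "geodesic_transversal G S \<longleftrightarrow> S \<subseteq> pverts G \<and>
     (\<forall>p. maximal_geodesic G p \<longrightarrow> set p \<inter> S \<noteq> {})"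

definition gt :: "'a pair_pre_digraph \<Rightarrow> nat" where
  "gt G = (LEAST k. \<exists>S. geodesic_transversal G S \<and> finite S \<and> card S = k)"

text \<open>Two triples are adjacent iff they differ in exactly one coordinate, and there by 1.\<close>

definition differ_by_one :: "nat \<Rightarrow> nat \<Rightarrow> bool" where
  "differ_by_one m n \<longleftrightarrow> m = n + 1 \<or> n = m + 1"

fun triple_adj :: "nat \<times> nat \<times> nat \<Rightarrow> nat \<times> nat \<times> nat \<Rightarrow> bool" where
  "triple_adj (a, b, c) (a', b', c') \<longleftrightarrow>
     differ_by_one a a' \<and> b = b' \<and> c = c' \<or>
     a = a' \<and> differ_by_one b b' \<and> c = c' \<or>
     a = a' \<and> b = b' \<and> differ_by_one c c'"

definition nanosheet_verts :: "nat \<Rightarrow> (nat \<times> nat \<times> nat) set" where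
  "nanosheet_verts r = {(a, b, c). a + b + c \<in> {r, r + 1}}"

text \<open>
  The single-hexagon sheet \<open>carbon_nanosheet 1\<close> is degenerate: \<open>{(1,0,0), (0,1,0)}\<close> meets
  all its maximal geodesics, so its geodesic transversal number is less than 3.
\<close>

definition carbon_nanosheet :: "nat \<Rightarrow> (nat \<times> nat \<times> nat) pair_pre_digraph" where
  "carbon_nanosheet r =
     \<lparr> pverts = nanosheet_verts r,
       parcs = {(u, v). u \<in> nanosheet_verts r \<and> v \<in> nanosheet_verts r \<and> triple_adj u v} \<rparr>"

lemma finite_nanosheet_verts: "finite (nanosheet_verts r)"
  by (rule finite_subset[of _ "{..r + 1} \<times> {..r + 1} \<times> {..r + 1}"])
     (auto simp: nanosheet_verts_def)

lemma pair_graph_carbon_nanosheet: "pair_graph (carbon_nanosheet r)"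
proof
  let ?V = "nanosheet_verts r"
  show "finite (pverts (carbon_nanosheet r))"
    by (simp add: carbon_nanosheet_def finite_nanosheet_verts)
  show "finite (parcs (carbon_nanosheet r))"
    by (rule finite_subset[of _ "?V \<times> ?V"])
       (auto simp: carbon_nanosheet_def finite_nanosheet_verts)
  show "symmetric (carbon_nanosheet r)"
    unfolding symmetric_def
    by (rule symI) (auto simp: carbon_nanosheet_def differ_by_one_def)
qed (auto simp: carbon_nanosheet_def differ_by_one_def)

end

theory Submission
  imports Defs
begin

text \<open>
  The nanosheet is an isometric subgraph of the grid \<open>\<int>\<^sup>3\<close>, so a walk is a geodesic iff its
  length is the \<open>\<ell>\<^sub>1\<close>-distance of its ends. If neither end of a geodesic can be
  moved further away from the other one, then one of the ends is a corner; hence the three corners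
  form a transversal. Conversely, the walks from a corner to the opposite side of length
  \<open>2r + 2\<close>, the diameter, are maximal geodesics. We use those that run along a side, and those
  that soon turn into the line parallel to a side at distance one. If a transversal with at most two
  vertices contains a vertex with two vanishing coordinates, say \<open>b = c = 0\<close>, then the other
  vertex would have to lie on the side \<open>a = 0\<close> and on both walks that start at an end of this
  side and turn into \<open>a = 1\<close>, which is impossible. Without such a vertex, two vertices cannot
  meet all three sides.
\<close>

section \<open>The l1 metric on triples\<close>

definition nat_dist :: "nat \<Rightarrow> nat \<Rightarrow> nat" where
  "nat_dist m n = (m - n) + (n - m)"

lemma nat_dist_commute: "nat_dist m n = nat_dist n m"
  by (simp add: nat_dist_def)

lemma nat_dist_eq_0_iff: "nat_dist m n = 0 \<longleftrightarrow> m = n"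
  by (auto simp: nat_dist_def)

lemma nat_dist_triangle: "nat_dist l n \<le> nat_dist l m + nat_dist m n"
  by (simp add: nat_dist_def)

lemma nat_dist_closer:
  "m < n \<Longrightarrow> nat_dist m n = Suc (nat_dist (Suc m) n)"
  "n < m \<Longrightarrow> nat_dist m n = Suc (nat_dist (m - Suc 0) n)"
  by (simp_all add: nat_dist_def)

fun l1_dist :: "nat \<times> nat \<times> nat \<Rightarrow> nat \<times> nat \<times> nat \<Rightarrow> nat" where
  "l1_dist (a, b, c) (a', b', c') = nat_dist a a' + nat_dist b b' + nat_dist c c'"

lemma l1_dist_commute: "l1_dist u v = l1_dist v u"
  by (cases u; cases v) (simp add: nat_dist_commute)

lemma l1_dist_eq_0_iff: "l1_dist u v = 0 \<longleftrightarrow> u = v"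
  by (cases u; cases v) (auto simp: nat_dist_eq_0_iff)

lemma l1_dist_triangle: "l1_dist u w \<le> l1_dist u v + l1_dist v w"
proof -
  obtain a b c a' b' c' a'' b'' c'' where "u = (a, b, c)" "v = (a', b', c')" "w = (a'', b'', c'')"
    by (cases u; cases v; cases w)
  then show ?thesis
    using nat_dist_triangle[of a a'' a'] nat_dist_triangle[of b b'' b'] nat_dist_triangle[of c c'' c']
    by simp
qed

lemma l1_dist_adj: "triple_adj u v \<Longrightarrow> l1_dist u v = 1"
  by (cases u; cases v) (auto simp: differ_by_one_def nat_dist_def)

text \<open>Two naturals differ by at most their sum, and each triple sums to at most
  \<open>r + 1\<close>. This bound is what makes geodesics of length \<open>2 * r + 2\<close>
  impossible to extend.\<close>

lemma l1_dist_le_diameter: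
  assumes "u \<in> nanosheet_verts r" "v \<in> nanosheet_verts r"
  shows "l1_dist u v \<le> 2 * r + 2"
proof -
  obtain a b c a' b' c' where "u = (a, b, c)" "v = (a', b', c')"
    by (cases u; cases v)
  moreover have "nat_dist m n \<le> m + n" for m n
    by (simp add: nat_dist_def)
  from this[of a a'] this[of b b'] this[of c c']
  have "l1_dist (a, b, c) (a', b', c') \<le> (a + b + c) + (a' + b' + c')"
    by simp
  ultimately show ?thesis
    using assms by (auto simp: nanosheet_verts_def)
qed

lemma triple_adj_commute: "triple_adj u v \<longleftrightarrow> triple_adj v u"
  by (cases u; cases v) (auto simp: differ_by_one_def)

text \<open>On the layer with sum \<open>r\<close> every coordinate may be raised. If none of
  \<open>u\<close> lay below that of \<open>v\<close>, then \<open>v\<close> would be coordinatewise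
  at most \<open>u\<close> with at least the same sum, hence equal to \<open>u\<close>. On the layer
  with sum \<open>r + 1\<close> the same argument works with lowering.\<close>

lemma ex_closer_neighbour:
  assumes "u \<in> nanosheet_verts r" "v \<in> nanosheet_verts r" "u \<noteq> v"
  shows "\<exists>w \<in> nanosheet_verts r. triple_adj u w \<and> l1_dist u v = Suc (l1_dist w v)"
proof -
  obtain a b c a' b' c' where uv: "u = (a, b, c)" "v = (a', b', c')"
    by (cases u; cases v)
  show ?thesis
  proof (cases "a + b + c = r")
    case True
    then consider "a < a'" | "b < b'" | "c < c'"
      using assms uv by (fastforce simp: nanosheet_verts_def)
    then show ?thesis
    proof cases
      case 1
      then show ?thesis
        using True uv by (intro bexI[of _ "(a + 1, b, c)"]) (auto simp: nanosheet_verts_def differ_by_one_def nat_dist_closer)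
    next
      case 2
      then show ?thesis
        using True uv by (intro bexI[of _ "(a, b + 1, c)"]) (auto simp: nanosheet_verts_def differ_by_one_def nat_dist_closer)
    next
      case 3
      then show ?thesis
        using True uv by (intro bexI[of _ "(a, b, c + 1)"]) (auto simp: nanosheet_verts_def differ_by_one_def nat_dist_closer)
    qed
  next
    case False
    then have s: "a + b + c = r + 1" "a' + b' + c' \<le> r + 1"
      using assms uv by (auto simp: nanosheet_verts_def)
    then consider "a > a'" | "b > b'" | "c > c'"
      using assms uv by fastforce
    then show ?thesis
    proof cases
      case 1
      then show ?thesis
        using s uv by (intro bexI[of _ "(a - 1, b, c)"]) (auto simp: nanosheet_verts_def differ_by_one_def nat_dist_closer)
    next
      case 2
      then show ?thesis
        using s uv by (intro bexI[of _ "(a, b - 1, c)"]) (auto simp: nanosheet_verts_def differ_by_one_def nat_dist_closer)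
    next
      case 3
      then show ?thesis
        using s uv by (intro bexI[of _ "(a, b, c - 1)"]) (auto simp: nanosheet_verts_def differ_by_one_def nat_dist_closer)
    qed
  qed
qed

section \<open>Geodesics as walks of l1 length\<close>

lemma vwalk_nanosheet_iff:
  "vwalk p (carbon_nanosheet r) \<longleftrightarrow>
     p \<noteq> [] \<and> set p \<subseteq> nanosheet_verts r \<and> successively triple_adj p"
proof -
  have "set (vwalk_arcs p) \<subseteq> parcs (carbon_nanosheet r) \<longleftrightarrow> successively triple_adj p"
    if "set p \<subseteq> nanosheet_verts r"
    using that by (induction p rule: vwalk_arcs.induct) (auto simp: carbon_nanosheet_def)
  then show ?thesis
    by (auto simp: vwalk_def carbon_nanosheet_def)
qed

text \<open>Each step changes the distance by at most 1. Allowing any \<open>x\<close> on the walk,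
  not only its head, serves to rule out repeated vertices in
  \<open>distinct_if_length_l1_dist\<close>.\<close>

lemma l1_dist_last_le_length:
  assumes "successively triple_adj p" "x \<in> set p"
  shows "l1_dist x (last p) \<le> length p - 1"
  using assms
proof (induction p arbitrary: x)
  case (Cons y p)
  show ?case
  proof (cases "p = []")
    case True
    then show ?thesis
      using Cons.prems by (simp add: l1_dist_eq_0_iff)
  next
    case False
    then have p: "successively triple_adj p" "triple_adj y (hd p)" "hd p \<in> set p" "length p > 0"
      using Cons.prems(1) by (auto simp: successively_Cons)
    show ?thesis
    proof (cases "x \<in> set p")
      case True
      then show ?thesis
        using Cons.IH[of x] p False by simp
    next
      case False
      then have "l1_dist x (last p) \<le> 1 + l1_dist (hd p) (last p)"
        using l1_dist_triangle[of y "last p" "hd p"] l1_dist_adj[OF p(2)] Cons.prems(2) by simp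
      also have "\<dots> \<le> length p"
        using Cons.IH[OF p(1,3)] p(4) by linarith
      finally show ?thesis
        using \<open>p \<noteq> []\<close> by simp
    qed
  qed
qed simp

text \<open>If the head recurred in the tail, the tail would be too short to cover the distance from
  there to the end. The tail attains its own distance as well, so induction applies.\<close>

lemma distinct_if_length_l1_dist:
  assumes "successively triple_adj p" "length p = Suc (l1_dist (hd p) (last p))"
  shows "distinct p"
  using assms
proof (induction p)
  case (Cons y p)
  show ?case
  proof (cases "p = []")
    case False
    then have p: "successively triple_adj p" "triple_adj y (hd p)" "hd p \<in> set p" "length p > 0"
      using Cons.prems(1) by (auto simp: successively_Cons)
    have len: "length p = l1_dist y (last p)"
      using Cons.prems(2) False by simp
    have "y \<notin> set p"
      using l1_dist_last_le_length[OF p(1), of y] len p(4) by linarith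
    moreover have "length p = Suc (l1_dist (hd p) (last p))"
      using l1_dist_last_le_length[OF p(1,3)] l1_dist_triangle[of y "last p" "hd p"]
        l1_dist_adj[OF p(2)] len p(4) by linarith
    ultimately show ?thesis
      using Cons.IH p(1) by simp
  qed simp
qed simp

lemma ex_vwalk_l1_dist:
  assumes "u \<in> nanosheet_verts r" "v \<in> nanosheet_verts r"
  shows "\<exists>p. vwalk p (carbon_nanosheet r) \<and> hd p = u \<and> last p = v \<and>
           length p = Suc (l1_dist u v)"
  using assms(1)
proof (induction "l1_dist u v" arbitrary: u)
  case 0
  then show ?case
    using assms(2) by (intro exI[of _ "[v]"]) (auto simp: vwalk_nanosheet_iff l1_dist_eq_0_iff)
next
  case (Suc n)
  then have "u \<noteq> v"
    by (metis l1_dist_eq_0_iff nat.distinct(1))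
  with ex_closer_neighbour[OF Suc.prems assms(2)] obtain w where
    w: "w \<in> nanosheet_verts r" "triple_adj u w" "l1_dist u v = Suc (l1_dist w v)"
    by blast
  then obtain p where "vwalk p (carbon_nanosheet r)" "hd p = w" "last p = v"
    "length p = Suc (l1_dist w v)"
    using Suc.hyps(1)[of w] Suc.hyps(2) by auto
  with w Suc.prems show ?case
    by (intro exI[of _ "u # p"]) (auto simp: vwalk_nanosheet_iff successively_Cons)
qed

text \<open>The l1 distance bounds the length of every walk from below. The walk from
  \<open>ex_vwalk_l1_dist\<close> attains this bound and is therefore a path, so it competes with
  \<open>p\<close>.\<close>

lemma geodesic_nanosheet_iff:
  "geodesic (carbon_nanosheet r) p \<longleftrightarrow>
     vwalk p (carbon_nanosheet r) \<and> length p = Suc (l1_dist (hd p) (last p))"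
proof
  assume geo: "geodesic (carbon_nanosheet r) p"
  then have p: "vwalk p (carbon_nanosheet r)"
    by (simp add: geodesic_def vpath_def)
  then have ends: "p \<noteq> []" "hd p \<in> nanosheet_verts r" "last p \<in> nanosheet_verts r"
    by (auto simp: vwalk_nanosheet_iff)
  from ex_vwalk_l1_dist[OF ends(2,3)] obtain q where
    q: "vwalk q (carbon_nanosheet r)" "hd q = hd p" "last q = last p"
      "length q = Suc (l1_dist (hd p) (last p))"
    by blast
  then have "vpath q (carbon_nanosheet r)"
    by (auto simp: vpath_def vwalk_nanosheet_iff distinct_if_length_l1_dist)
  then have "length p - 1 \<le> length q - 1"
    using geo q by (auto simp: geodesic_def)
  moreover have "l1_dist (hd p) (last p) \<le> length p - 1"
    using p by (intro l1_dist_last_le_length) (auto simp: vwalk_nanosheet_iff)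
  moreover have "length p > 0"
    using ends(1) by simp
  ultimately show "vwalk p (carbon_nanosheet r) \<and> length p = Suc (l1_dist (hd p) (last p))"
    using p q(4) by linarith
next
  assume p: "vwalk p (carbon_nanosheet r) \<and> length p = Suc (l1_dist (hd p) (last p))"
  moreover have "length p - 1 \<le> length q - 1"
    if "vpath q (carbon_nanosheet r)" "hd q = hd p" "last q = last p" for q
  proof -
    have "successively triple_adj q" "hd q \<in> set q"
      using that(1) by (auto simp: vpath_def vwalk_nanosheet_iff)
    then show ?thesis
      using l1_dist_last_le_length[of q "hd q"] p that(2,3) by simp
  qed
  ultimately show "geodesic (carbon_nanosheet r) p"
    by (auto simp: geodesic_def vpath_def vwalk_nanosheet_iff distinct_if_length_l1_dist)
qed

section \<open>Ends of maximal geodesics and the upper bound\<close>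

lemma maximal_geodesic_last:
  assumes "maximal_geodesic (carbon_nanosheet r) p"
    and "w \<in> nanosheet_verts r" "triple_adj (last p) w"
  shows "l1_dist (hd p) w \<le> l1_dist (hd p) (last p)"
proof (rule ccontr)
  assume "\<not> ?thesis"
  moreover have "l1_dist (hd p) w \<le> Suc (l1_dist (hd p) (last p))"
    using l1_dist_triangle[of "hd p" w "last p"] l1_dist_adj[OF assms(3)] by simp
  ultimately have "l1_dist (hd p) w = Suc (l1_dist (hd p) (last p))"
    by simp
  then have "geodesic (carbon_nanosheet r) (p @ [w])"
    using assms
    by (auto simp: maximal_geodesic_def geodesic_nanosheet_iff vwalk_nanosheet_iff
        successively_append_iff)
  moreover have "\<not> same_path p (p @ [w])"
    by (auto simp: same_path_def dest: arg_cong[where f = length])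
  ultimately show False
    using assms(1) by (auto simp: maximal_geodesic_def subpath_def)
qed

lemma maximal_geodesic_hd:
  assumes "maximal_geodesic (carbon_nanosheet r) p"
    and "w \<in> nanosheet_verts r" "triple_adj (hd p) w"
  shows "l1_dist w (last p) \<le> l1_dist (hd p) (last p)"
proof (rule ccontr)
  assume "\<not> ?thesis"
  moreover have "l1_dist w (last p) \<le> Suc (l1_dist (hd p) (last p))"
    using l1_dist_triangle[of w "last p" "hd p"] l1_dist_adj[OF assms(3)]
    by (simp add: l1_dist_commute)
  ultimately have "l1_dist w (last p) = Suc (l1_dist (hd p) (last p))"
    by simp
  then have "geodesic (carbon_nanosheet r) (w # p)"
    using assms
    by (auto simp: maximal_geodesic_def geodesic_nanosheet_iff vwalk_nanosheet_iff
        successively_Cons triple_adj_commute)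
  moreover have "\<not> same_path p (w # p)"
    by (auto simp: same_path_def dest: arg_cong[where f = length])
  ultimately show False
    using assms(1) by (auto simp: maximal_geodesic_def subpath_def sublist_Cons_right)
qed

text \<open>If the sum were \<open>r\<close>, each coordinate could be raised, so \<open>far\<close>
  would put each strictly below its counterpart, and the other triple would sum to at least
  \<open>r + 3\<close>. On the upper layer each positive coordinate can be lowered, so
  \<open>far\<close> puts it above its counterpart.\<close>

lemma locally_farthest:
  assumes "(a, b, c) \<in> nanosheet_verts r" "(a', b', c') \<in> nanosheet_verts r"
    and far: "\<And>w. w \<in> nanosheet_verts r \<Longrightarrow> triple_adj (a, b, c) w \<Longrightarrow>
           l1_dist (a', b', c') w \<le> l1_dist (a', b', c') (a, b, c)"
  shows "a + b + c = r + 1 \<and> (a = 0 \<or> a' < a) \<and> (b = 0 \<or> b' < b) \<and> (c = 0 \<or> c' < c)"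
proof -
  have "a < a'" if "a + b + c = r"
    using that far[of "(a + 1, b, c)"] by (simp add: nanosheet_verts_def differ_by_one_def nat_dist_def)
  moreover have "b < b'" if "a + b + c = r"
    using that far[of "(a, b + 1, c)"] by (simp add: nanosheet_verts_def differ_by_one_def nat_dist_def)
  moreover have "c < c'" if "a + b + c = r"
    using that far[of "(a, b, c + 1)"] by (simp add: nanosheet_verts_def differ_by_one_def nat_dist_def)
  ultimately have sum: "a + b + c = r + 1"
    using assms(1,2) by (fastforce simp: nanosheet_verts_def)
  have "a' < a" if "a > 0"
    using that sum far[of "(a - 1, b, c)"] by (auto simp: nanosheet_verts_def differ_by_one_def nat_dist_def)
  moreover have "b' < b" if "b > 0"
    using that sum far[of "(a, b - 1, c)"] by (auto simp: nanosheet_verts_def differ_by_one_def nat_dist_def)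
  moreover have "c' < c" if "c > 0"
    using that sum far[of "(a, b, c - 1)"] by (auto simp: nanosheet_verts_def differ_by_one_def nat_dist_def)
  ultimately show ?thesis
    using sum by blast
qed

text \<open>By \<open>locally_farthest\<close> at both ends, no coordinate is positive at both.
  Three coordinates shared between two ends leave one end with a single positive coordinate, which
  is then \<open>r + 1\<close>.\<close>

lemma maximal_geodesic_corner:
  assumes "maximal_geodesic (carbon_nanosheet r) p"
  shows "set p \<inter> {(r + 1, 0, 0), (0, r + 1, 0), (0, 0, r + 1)} \<noteq> {}"
proof -
  have "p \<noteq> []" "set p \<subseteq> nanosheet_verts r"
    using assms by (auto simp: maximal_geodesic_def geodesic_nanosheet_iff vwalk_nanosheet_iff)
  then have ends: "hd p \<in> set p" "last p \<in> set p"
    "hd p \<in> nanosheet_verts r" "last p \<in> nanosheet_verts r"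
    by auto
  obtain a b c a' b' c' where eq: "hd p = (a, b, c)" "last p = (a', b', c')"
    by (cases "hd p"; cases "last p")
  have "a + b + c = r + 1 \<and> (a = 0 \<or> a' < a) \<and> (b = 0 \<or> b' < b) \<and> (c = 0 \<or> c' < c)"
    using ends(3,4) maximal_geodesic_hd[OF assms] unfolding eq
    by (intro locally_farthest) (simp_all only: l1_dist_commute)
  moreover have
    "a' + b' + c' = r + 1 \<and> (a' = 0 \<or> a < a') \<and> (b' = 0 \<or> b < b') \<and> (c' = 0 \<or> c < c')"
    using ends(3,4) maximal_geodesic_last[OF assms] unfolding eq
    by (intro locally_farthest)
  ultimately have "a + b + c = r + 1" "a' + b' + c' = r + 1"
      "a = 0 \<or> a' = 0" "b = 0 \<or> b' = 0" "c = 0 \<or> c' = 0"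
    by linarith+
  then have "hd p \<in> {(r + 1, 0, 0), (0, r + 1, 0), (0, 0, r + 1)} \<or>
      last p \<in> {(r + 1, 0, 0), (0, r + 1, 0), (0, 0, r + 1)}"
    unfolding eq by (cases "a = 0"; cases "b = 0"; cases "c = 0") simp_all
  then show ?thesis
    using ends(1,2) by blast
qed

lemma geodesic_transversal_corners:
  "geodesic_transversal (carbon_nanosheet r) {(r + 1, 0, 0), (0, r + 1, 0), (0, 0, r + 1)}"
  using maximal_geodesic_corner
  by (auto simp: geodesic_transversal_def carbon_nanosheet_def nanosheet_verts_def)

section \<open>Diametral routes from the corners\<close>

lemma maximal_geodesic_if_diameter:
  assumes "vwalk p (carbon_nanosheet r)" "length p = 2 * r + 3"
    and "l1_dist (hd p) (last p) = 2 * r + 2"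
  shows "maximal_geodesic (carbon_nanosheet r) p"
proof -
  have "same_path p q" if q: "geodesic (carbon_nanosheet r) q" "subpath p q" for q
  proof -
    \<comment> \<open>A path containing \<open>p\<close> that is no longer than \<open>p\<close> is
      \<open>p\<close> itself, up to reversal.\<close>
    have "length q \<le> length p"
    proof -
      have "hd q \<in> nanosheet_verts r" "last q \<in> nanosheet_verts r"
        using q(1) by (auto simp: geodesic_nanosheet_iff vwalk_nanosheet_iff)
      then show ?thesis
        using q(1) l1_dist_le_diameter[of "hd q" r "last q"] assms(2)
        by (simp add: geodesic_nanosheet_iff)
    qed
    then show ?thesis
      using q(2) by (auto simp: subpath_def same_path_def sublist_def)
  qed
  then show ?thesis
    using assms by (auto simp: maximal_geodesic_def geodesic_nanosheet_iff)
qed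

text \<open>Captures what the coordinate permutations preserve, so that routes need to be examined
  from one corner only.\<close>

definition sheet_symmetry :: "(nat \<times> nat \<times> nat \<Rightarrow> nat \<times> nat \<times> nat) \<Rightarrow> bool" where
  "sheet_symmetry \<sigma> \<longleftrightarrow>
     (\<forall>r u. u \<in> nanosheet_verts r \<longrightarrow> \<sigma> u \<in> nanosheet_verts r) \<and>
     (\<forall>u v. triple_adj u v \<longrightarrow> triple_adj (\<sigma> u) (\<sigma> v)) \<and>
     (\<forall>u v. l1_dist (\<sigma> u) (\<sigma> v) = l1_dist u v)"

text \<open>
  The \<open>i\<close>-th vertex of a walk from the corner \<open>(0, 0, r + 1)\<close>, which runs along the side
  \<open>b = 0\<close> up to \<open>a = m\<close> and turns into the line \<open>a = m\<close> there.
\<close>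
definition route :: "nat \<Rightarrow> nat \<Rightarrow> nat \<Rightarrow> nat \<times> nat \<times> nat" where
  "route r m i = (min m (i div 2), i div 2 - m, r + 1 - (i + 1) div 2)"

text \<open>Even indices lie on the layer \<open>r + 1\<close>, odd ones on the layer
  \<open>r\<close>. A step from an even index lowers the third coordinate; a step from an odd index
  raises the first up to \<open>m\<close>, then the second. The ends have no common positive
  coordinate, hence distance \<open>2 * r + 2\<close>.\<close>

lemma maximal_geodesic_route:
  assumes "sheet_symmetry \<sigma>"
  shows "maximal_geodesic (carbon_nanosheet r) (map (\<lambda>i. \<sigma> (route r m i)) [0..<2 * r + 3])"
proof (rule maximal_geodesic_if_diameter)
  have "route r m i \<in> nanosheet_verts r" if "i < 2 * r + 3" for i
  proof -
    have "min m (i div 2) + (i div 2 - m) = i div 2"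
      by simp
    moreover have "i div 2 + (r + 1 - (i + 1) div 2) \<in> {r, r + 1}"
      using that by (cases "even i") (auto elim!: evenE oddE)
    ultimately show ?thesis
      by (simp add: route_def nanosheet_verts_def)
  qed
  moreover have "triple_adj (route r m i) (route r m (Suc i))" if "Suc i < 2 * r + 3" for i
  proof (cases "even i")
    case True
    then obtain k where k: "i = 2 * k" by (elim evenE)
    then have "k \<le> r" using that by simp
    then show ?thesis using k by (simp add: route_def differ_by_one_def Suc_diff_le)
  next
    case False
    then obtain k where "i = 2 * k + 1" by (elim oddE)
    then show ?thesis using that by (auto simp: route_def differ_by_one_def)
  qed
  ultimately have "\<sigma> (route r m i) \<in> nanosheet_verts r"
      "Suc i < 2 * r + 3 \<Longrightarrow> triple_adj (\<sigma> (route r m i)) (\<sigma> (route r m (Suc i)))"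
    if "i < 2 * r + 3" for i
    using that assms unfolding sheet_symmetry_def by blast+
  then show "vwalk (map (\<lambda>i. \<sigma> (route r m i)) [0..<2 * r + 3]) (carbon_nanosheet r)"
    by (auto simp: vwalk_nanosheet_iff successively_conv_nth image_subset_iff simp del: upt_Suc)
  have "l1_dist (route r m 0) (route r m (2 * r + 2)) = 2 * r + 2"
    by (simp add: route_def nat_dist_def)
  then have "l1_dist (\<sigma> (route r m 0)) (\<sigma> (route r m (2 * r + 2))) = 2 * r + 2"
    using assms unfolding sheet_symmetry_def by presburger
  then show "l1_dist (hd (map (\<lambda>i. \<sigma> (route r m i)) [0..<2 * r + 3]))
      (last (map (\<lambda>i. \<sigma> (route r m i)) [0..<2 * r + 3])) = 2 * r + 2"
    by (simp add: hd_map last_map del: upt_Suc)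
qed simp

section \<open>The lower bound\<close>

lemma transversal_meets_route:
  assumes "geodesic_transversal (carbon_nanosheet r) S" "sheet_symmetry \<sigma>"
  shows "\<exists>i. \<sigma> (route r m i) \<in> S"
  using assms(1) maximal_geodesic_route[OF assms(2), of r m]
  by (fastforce simp: geodesic_transversal_def)

text \<open>For \<open>m = 0\<close> the route never leaves the side where the first coordinate is
  0.\<close>

lemma transversal_meets_side:
  assumes "geodesic_transversal (carbon_nanosheet r) S" "sheet_symmetry \<sigma>"
  shows "\<exists>b c. \<sigma> (0, b, c) \<in> S"
  using transversal_meets_route[OF assms, of 0] by (auto simp: route_def)

text \<open>For \<open>m = 1\<close> only the vertices with index 0 and 1 precede the line where the
  first coordinate is 1; both have the form \<open>(0, 0, c)\<close>.\<close>

lemma transversal_meets_parallel: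
  assumes "geodesic_transversal (carbon_nanosheet r) S" "sheet_symmetry \<sigma>"
  shows "\<exists>b c. \<sigma> (1, b, c) \<in> S \<or> \<sigma> (0, 0, c) \<in> S"
proof -
  from transversal_meets_route[OF assms, of 1] obtain i where i: "\<sigma> (route r 1 i) \<in> S"
    by blast
  show ?thesis
  proof (cases "i div 2 = 0")
    case True
    then show ?thesis using i by (auto simp: route_def)
  next
    case False
    then have "min 1 (i div 2) = 1" by simp
    then show ?thesis using i unfolding route_def by metis
  qed
qed

lemma sheet_symmetry_permutations:
  "sheet_symmetry (\<lambda>(a, b, c). (a, b, c))" "sheet_symmetry (\<lambda>(a, b, c). (a, c, b))"
  "sheet_symmetry (\<lambda>(a, b, c). (b, a, c))" "sheet_symmetry (\<lambda>(a, b, c). (c, a, b))"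
  "sheet_symmetry (\<lambda>(a, b, c). (b, c, a))" "sheet_symmetry (\<lambda>(a, b, c). (c, b, a))"
  by (auto simp: sheet_symmetry_def nanosheet_verts_def)

lemma transversal_not_pair:
  assumes "r \<ge> 2" "geodesic_transversal (carbon_nanosheet r) S"
  shows "\<not> S \<subseteq> {s, t}"
proof
  assume S: "S \<subseteq> {s, t}"
  obtain a b c a' b' c' where st: "s = (a, b, c)" "t = (a', b', c')"
    by (cases s; cases t)
  \<comment> \<open>Membership in \<open>S\<close> is kept in each disjunct because \<open>S\<close>
    may be smaller than \<open>{s, t}\<close>; it later gives access to the coordinate sums.\<close>
  have pick: "s \<in> S \<and> P (a, b, c) \<or> t \<in> S \<and> P (a', b', c')" if "u \<in> S" "P u" for P u
    using that S st by blast
  \<comment> \<open>Permutations 1, 3 and 6 send the first coordinate to the first, second and third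
    place, one for each side.\<close>
  note meets_side = sheet_symmetry_permutations[THEN transversal_meets_side[OF assms(2)]]
  have side1: "s \<in> S \<and> a = 0 \<or> t \<in> S \<and> a' = 0"
    using meets_side(1) pick[where P = "\<lambda>(x, y, z). x = 0"] by auto
  have side2: "s \<in> S \<and> b = 0 \<or> t \<in> S \<and> b' = 0"
    using meets_side(3) pick[where P = "\<lambda>(x, y, z). y = 0"] by auto
  have side3: "s \<in> S \<and> c = 0 \<or> t \<in> S \<and> c' = 0"
    using meets_side(6) pick[where P = "\<lambda>(x, y, z). z = 0"] by auto
  note meets_parallel = sheet_symmetry_permutations[THEN transversal_meets_parallel[OF assms(2)]]
  have par1: "s \<in> S \<and> (a = 1 \<or> a = 0 \<and> b = 0) \<or> t \<in> S \<and> (a' = 1 \<or> a' = 0 \<and> b' = 0)"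
    using meets_parallel(1) pick[where P = "\<lambda>(x, y, z). x = 1 \<or> x = 0 \<and> y = 0"] by auto
  have par2: "s \<in> S \<and> (a = 1 \<or> a = 0 \<and> c = 0) \<or> t \<in> S \<and> (a' = 1 \<or> a' = 0 \<and> c' = 0)"
    using meets_parallel(2) pick[where P = "\<lambda>(x, y, z). x = 1 \<or> x = 0 \<and> z = 0"] by auto
  have par3: "s \<in> S \<and> (b = 1 \<or> b = 0 \<and> a = 0) \<or> t \<in> S \<and> (b' = 1 \<or> b' = 0 \<and> a' = 0)"
    using meets_parallel(3) pick[where P = "\<lambda>(x, y, z). y = 1 \<or> y = 0 \<and> x = 0"] by auto
  have par4: "s \<in> S \<and> (b = 1 \<or> b = 0 \<and> c = 0) \<or> t \<in> S \<and> (b' = 1 \<or> b' = 0 \<and> c' = 0)"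
    using meets_parallel(4) pick[where P = "\<lambda>(x, y, z). y = 1 \<or> y = 0 \<and> z = 0"] by auto
  have par5: "s \<in> S \<and> (c = 1 \<or> c = 0 \<and> a = 0) \<or> t \<in> S \<and> (c' = 1 \<or> c' = 0 \<and> a' = 0)"
    using meets_parallel(5) pick[where P = "\<lambda>(x, y, z). z = 1 \<or> z = 0 \<and> x = 0"] by auto
  have par6: "s \<in> S \<and> (c = 1 \<or> c = 0 \<and> b = 0) \<or> t \<in> S \<and> (c' = 1 \<or> c' = 0 \<and> b' = 0)"
    using meets_parallel(6) pick[where P = "\<lambda>(x, y, z). z = 1 \<or> z = 0 \<and> y = 0"] by auto
  have "S \<subseteq> nanosheet_verts r"
    using assms(2) by (simp add: geodesic_transversal_def carbon_nanosheet_def)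
  \<comment> \<open>Here \<open>r \<ge> 2\<close> enters: the pair \<open>(1, 0, 0)\<close>,
    \<open>(0, 1, 0)\<close> satisfies all nine conditions above and is excluded only by its
    sums.\<close>
  then have "s \<in> S \<Longrightarrow> a + b + c \<ge> 2" "t \<in> S \<Longrightarrow> a' + b' + c' \<ge> 2"
    using assms(1) unfolding st by (auto simp: nanosheet_verts_def)
  then show False
    using side1 side2 side3 par1 par2 par3 par4 par5 par6
    by (cases "a = 0"; cases "b = 0"; cases "c = 0"; cases "a' = 0"; cases "b' = 0"; cases "c' = 0") auto
qed

lemma transversal_card_ge:
  assumes "r \<ge> 2" "geodesic_transversal (carbon_nanosheet r) S" "finite S"
  shows "card S \<ge> 3"
proof (rule ccontr)
  assume "\<not> ?thesis"
  then consider "card S = 0" | "card S = 1" | "card S = 2"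
    by linarith
  then have "\<exists>s t. S \<subseteq> {s, t}"
  proof cases
    case 1
    then show ?thesis using assms(3) by simp
  next
    case 2
    then show ?thesis by (metis card_1_singletonE subset_insertI)
  next
    case 3
    then show ?thesis by (metis card_2_iff order_refl)
  qed
  then show False
    using transversal_not_pair[OF assms(1,2)] by blast
qed

theorem proposition2p1:
  fixes r :: nat
  assumes "r \<ge> 2"
  shows "gt (carbon_nanosheet r) = 3"
  unfolding gt_def
proof (rule Least_equality)
  show "\<exists>S. geodesic_transversal (carbon_nanosheet r) S \<and> finite S \<and> card S = 3"
    using geodesic_transversal_corners[of r] by (intro exI conjI) auto
qed (use transversal_card_ge[OF assms] in blast)

end
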